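(* Let $n\ge 2$. A multivariate expansion is linear: for every expansion operator $T$, either $T=T_{[x_i]}$ for some $1\le i\le n$, or a mixed expansion operator $T=T_{\otimes_{i=1}^{l}[x_{\sigma(i)}]}$ with $1\le l\le n$ and $\sigma$ a permutation of $\{1,\dots,l\}$, for all $n$-tuples $\mathcal{S}_a,\mathcal{S}_b$ of polynomials in $\mathbb{R}[x_1,\dots,x_n]$ and all $\lambda,\mu\in\mathbb{R}$, $$T(\lambda\mathcal{S}_a+\mu\mathcal{S}_b)=\lambda\,T(\mathcal{S}_a)+\mu\,T(\mathcal{S}_b).$$
   Context: Tuples are $n$-tuples $\mathcal{S}=(f_1,\dots,f_n)$ of polynomials $f_k\in\mathbb{R}[x_1,\dots,x_n]$, with $n\ge 2$, added and scaled entrywise. The expansion in the direction $x_i$ is $T_{[x_i]}:=(\gamma^{-1}\circ\beta\circ\gamma\circ\nabla)_{[x_i]}$, where $\nabla_{[x_i]}(\mathcal{S})=(\partial f_1/\partial x_i,\dots,\partial f_n/\partial x_i)$, $\gamma$ turns a tuple into the corresponding column vector, and $\beta$ multiplies a column vector by the $n\times n$ matrix with $0$ on the diagonal and $1$ elsewhere. Thus the $r$-th entry of $T_{[x_i]}(\mathcal{S})$ is $\sum_{t\ne r}\partial f_t/\partial x_i$. The mixed expansion in the direction $\otimes_{i=1}^{l}[x_{\sigma(i)}]$ is the composition $T_{\otimes_{i=1}^{l}[x_{\sigma(i)}]}=T_{[x_{\sigma(l)}]}\circ\cdots\circ T_{[x_{\sigma(1)}]}$. *)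

theory Defs
  imports "HOL-Library.Poly_Mapping" "HOL-Combinatorics.Permutations" "Jordan_Normal_Form.Matrix"
begin

text \<open>Real polynomials in the variables \<open>x\<^sub>i\<close> (\<open>i :: nat\<close>): finitely supported maps from
  exponent vectors to coefficients, with the ring structure of \<^theory>\<open>HOL-Library.Poly_Mapping\<close>.
  The ring \<open>\<real>[x\<^sub>1,\<dots>,x\<^sub>n]\<close> is the set of those polynomials in which only \<open>x\<^sub>1,\<dots>,x\<^sub>n\<close> occur.\<close>

type_synonym rpoly = "(nat \<Rightarrow>\<^sub>0 nat) \<Rightarrow>\<^sub>0 real"

definition poly_ring :: "nat \<Rightarrow> rpoly set" where
  "poly_ring n = {p. \<forall>m \<in> Poly_Mapping.keys p. Poly_Mapping.keys m \<subseteq> {1..n}}"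

text \<open>Termwise, \<open>\<partial>(c x\<^sup>m)/\<partial>x\<^sub>i = m\<^sub>i c x\<^bsup>m - e\<^sub>i\<^esup>\<close>.  Subtraction of exponent vectors is truncated,
  but it truncates only where \<open>m\<^sub>i = 0\<close>, and then the coefficient vanishes.\<close>

definition partial_deriv :: "nat \<Rightarrow> rpoly \<Rightarrow> rpoly" where
  "partial_deriv i p =
     (\<Sum>m \<in> Poly_Mapping.keys p.
        Poly_Mapping.single (m - Poly_Mapping.single i 1)
          (of_nat (Poly_Mapping.lookup m i) * Poly_Mapping.lookup p m))"

type_synonym tuple = "rpoly list"

text \<open>Mathematical entry \<open>f\<^sub>k\<close> (\<open>1 \<le> k \<le> n\<close>) of a tuple is list entry \<open>k - 1\<close>;
  variables keep their indices \<open>1, \<dots>, n\<close>.\<close>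

definition tuples :: "nat \<Rightarrow> tuple set" where
  "tuples n = {S. length S = n \<and> set S \<subseteq> poly_ring n}"

definition tuple_add :: "tuple \<Rightarrow> tuple \<Rightarrow> tuple" (infixl \<open>\<oplus>\<^sub>T\<close> 65) where
  "S \<oplus>\<^sub>T S' = map2 (+) S S'"

definition tuple_scale :: "real \<Rightarrow> tuple \<Rightarrow> tuple" (infixr \<open>\<odot>\<^sub>T\<close> 75) where
  "c \<odot>\<^sub>T S = map (Poly_Mapping.map ((*) c)) S"

definition nabla :: "nat \<Rightarrow> tuple \<Rightarrow> tuple" where
  "nabla i S = map (partial_deriv i) S"

definition gamma :: "tuple \<Rightarrow> rpoly vec" where
  "gamma = vec_of_list"

definition gamma_inv :: "rpoly vec \<Rightarrow> tuple" where
  "gamma_inv = list_of_vec"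

definition beta :: "nat \<Rightarrow> rpoly vec \<Rightarrow> rpoly vec" where
  "beta n v = mat n n (\<lambda>(r, t). if r = t then 0 else 1) *\<^sub>v v"

definition expansion :: "nat \<Rightarrow> nat \<Rightarrow> tuple \<Rightarrow> tuple" where
  "expansion n i = gamma_inv \<circ> beta n \<circ> gamma \<circ> nabla i"

lemma expansion_nth:
  assumes "length S = n" "r < n"
  shows "expansion n i S ! r = (\<Sum>t \<in> {..<n} - {r}. partial_deriv i (S ! t))"
proof -
  have "expansion n i S ! r = (\<Sum>t<n. (if r = t then 0 else 1) * partial_deriv i (S ! t))"
    using assms by (simp add: expansion_def nabla_def gamma_def gamma_inv_def beta_def
      list_of_vec_index scalar_prod_def vec_of_list_index atLeast0LessThan del: vec_of_list_map)
  also have "\<dots> = (\<Sum>t \<in> {..<n} - {r}. partial_deriv i (S ! t))"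
    by (rule sum.mono_neutral_cong_right) auto
  finally show ?thesis .
qed

text \<open>\<open>T\<close> in direction \<open>x\<^bsub>\<sigma>(1)\<^esub>\<close> is applied first, \<open>T\<close> in direction \<open>x\<^bsub>\<sigma>(l)\<^esub>\<close> last.\<close>

primrec mixed_expansion :: "nat \<Rightarrow> nat \<Rightarrow> (nat \<Rightarrow> nat) \<Rightarrow> tuple \<Rightarrow> tuple" where
  "mixed_expansion n 0 \<sigma> = id"
| "mixed_expansion n (Suc l) \<sigma> = expansion n (\<sigma> (Suc l)) \<circ> mixed_expansion n l \<sigma>"

definition is_expansion :: "nat \<Rightarrow> (tuple \<Rightarrow> tuple) \<Rightarrow> bool" where
  "is_expansion n T \<longleftrightarrow>
     (\<exists>i \<in> {1..n}. T = expansion n i) \<or>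
     (\<exists>l \<in> {1..n}. \<exists>\<sigma>. \<sigma> permutes {1..l} \<and> T = mixed_expansion n l \<sigma>)"

end

theory Submission
  imports Defs
begin

text \<open>
  Partial differentiation is linear because it acts monomial by monomial and each monomial
  contributes a term that depends linearly on its coefficient (\<open>partial_deriv_linear\<close>).  By
  \<open>expansion_nth\<close> every entry of an expansion is a sum of partial derivatives of entries of the
  tuple, so a single expansion is linear.  A mixed expansion is a composition of single expansions,
  and linearity passes to compositions.

  Tuples are lists, and entrywise addition of lists is only meaningful for equal lengths.  Linearity
  is therefore carried through the composition together with the invariant that an expansion maps
  lists of length \<open>n\<close> to lists of length \<open>n\<close>.
\<close>

lemma lookup_map_times [simp]:
  "Poly_Mapping.lookup (Poly_Mapping.map ((*) c) p) k = c * Poly_Mapping.lookup p k"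
  for c :: real
  by (simp add: Poly_Mapping.map.rep_eq when_def)

text \<open>Summing over all of a fixed finite set of monomials, instead of over the support of the
  polynomial, gives sums over a common index set for different polynomials.\<close>

lemma partial_deriv_superset:
  assumes "finite A" "Poly_Mapping.keys p \<subseteq> A"
  shows "partial_deriv i p =
    (\<Sum>m\<in>A. Poly_Mapping.single (m - Poly_Mapping.single i 1)
       (of_nat (Poly_Mapping.lookup m i) * Poly_Mapping.lookup p m))"
  unfolding partial_deriv_def
  by (rule sum.mono_neutral_left) (use assms in \<open>auto simp: in_keys_iff\<close>)

lemma partial_deriv_linear:
  "partial_deriv i (Poly_Mapping.map ((*) a) p + Poly_Mapping.map ((*) b) q) =
   Poly_Mapping.map ((*) a) (partial_deriv i p) + Poly_Mapping.map ((*) b) (partial_deriv i q)"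
proof -
  define A where "A = Poly_Mapping.keys p \<union> Poly_Mapping.keys q"
  have A: "finite A" "Poly_Mapping.keys p \<subseteq> A" "Poly_Mapping.keys q \<subseteq> A"
    "Poly_Mapping.keys (Poly_Mapping.map ((*) a) p + Poly_Mapping.map ((*) b) q) \<subseteq> A"
    by (auto simp: A_def in_keys_iff lookup_add)
  show ?thesis
    by (rule poly_mapping_eqI)
      (simp add: A partial_deriv_superset[of A] lookup_add lookup_sum lookup_single
        sum_distrib_left flip: sum.distrib, intro sum.cong, auto simp: when_def algebra_simps)
qed

lemma map_times_sum:
  "Poly_Mapping.map ((*) (c :: real)) (sum f A) = (\<Sum>t\<in>A. Poly_Mapping.map ((*) c) (f t))"
  by (rule poly_mapping_eqI) (simp add: lookup_sum sum_distrib_left)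

lemma length_expansion [simp]: "length (expansion n i S) = n"
  by (simp add: expansion_def gamma_inv_def beta_def)

lemma length_mixed_expansion:
  "length S = n \<Longrightarrow> length (mixed_expansion n l \<sigma> S) = n"
  by (induction l) simp_all

lemma length_tuple_add [simp]: "length (S \<oplus>\<^sub>T S') = min (length S) (length S')"
  by (simp add: tuple_add_def)

lemma length_tuple_scale [simp]: "length (c \<odot>\<^sub>T S) = length S"
  by (simp add: tuple_scale_def)

lemma tuple_combination_nth:
  assumes "r < length S" "r < length S'"
  shows "(a \<odot>\<^sub>T S \<oplus>\<^sub>T b \<odot>\<^sub>T S') ! r =
    Poly_Mapping.map ((*) a) (S ! r) + Poly_Mapping.map ((*) b) (S' ! r)"
  using assms by (simp add: tuple_add_def tuple_scale_def)

lemma expansion_linear: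
  assumes "length S = n" "length S' = n"
  shows "expansion n i (a \<odot>\<^sub>T S \<oplus>\<^sub>T b \<odot>\<^sub>T S') =
    a \<odot>\<^sub>T expansion n i S \<oplus>\<^sub>T b \<odot>\<^sub>T expansion n i S'"
proof (rule nth_equalityI)
  fix r assume "r < length (expansion n i (a \<odot>\<^sub>T S \<oplus>\<^sub>T b \<odot>\<^sub>T S'))"
  then have "r < n" by simp
  then show "expansion n i (a \<odot>\<^sub>T S \<oplus>\<^sub>T b \<odot>\<^sub>T S') ! r =
      (a \<odot>\<^sub>T expansion n i S \<oplus>\<^sub>T b \<odot>\<^sub>T expansion n i S') ! r"
    using assms
    by (simp add: expansion_nth tuple_combination_nth partial_deriv_linear map_times_sum
        sum.distrib)
qed simp

lemma mixed_expansion_linear: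
  assumes "length S = n" "length S' = n"
  shows "mixed_expansion n l \<sigma> (a \<odot>\<^sub>T S \<oplus>\<^sub>T b \<odot>\<^sub>T S') =
    a \<odot>\<^sub>T mixed_expansion n l \<sigma> S \<oplus>\<^sub>T b \<odot>\<^sub>T mixed_expansion n l \<sigma> S'"
  using assms by (induction l) (simp_all add: expansion_linear length_mixed_expansion)

theorem proposition2p2:
  fixes n :: nat
    and T :: "tuple \<Rightarrow> tuple"
    and Sa Sb :: tuple
    and a b :: real
  assumes "n \<ge> 2"
    and "is_expansion n T"
    and "Sa \<in> tuples n"
    and "Sb \<in> tuples n"
  shows "T (a \<odot>\<^sub>T Sa \<oplus>\<^sub>T b \<odot>\<^sub>T Sb) = a \<odot>\<^sub>T T Sa \<oplus>\<^sub>T b \<odot>\<^sub>T T Sb"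
proof -
  have "length Sa = n" "length Sb = n"
    using assms(3,4) by (simp_all add: tuples_def)
  with assms(2) show ?thesis
    by (auto simp: is_expansion_def expansion_linear mixed_expansion_linear)
qed

end
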